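(* Let $\mathfrak B$ be a real or complex Banach space and let $\varphi\in C(\mathbb R,\mathfrak B)$ be positively Lagrange stable in the shift dynamical system $(C(\mathbb R,\mathfrak B),\mathbb R,\sigma)$. Assume that: (1) $\varphi$ is positively remotely almost periodic (respectively, positively remotely $\tau$-periodic for a given $\tau>0$; or positively remotely stationary), and its $\omega$-limit set $\omega_\varphi$ is a minimal set of the shift dynamical system $(C(\mathbb R,\mathfrak B),\mathbb R,\sigma)$; (2) the primitive $F(t):=\int_0^t\varphi(s)\,ds$ is precompact, i.e. $\overline{F(\mathbb R_+)}$ is a compact subset of $\mathfrak B$. Then $F$ is positively remotely almost periodic (respectively, positively remotely $\tau$-periodic; or positively remotely stationary).
   Context: $|\cdot|$ is the norm of $\mathfrak B$; $\mathbb R_+=[0,\infty)$. $C(\mathbb R,\mathfrak B)$ is the space of continuous functions $\mathbb R\to\mathfrak B$ with the compact-open topology, and the shift dynamical system is $\sigma(h,f)=f^h$, $f^h(t)=f(t+h)$, $h\in\mathbb R$. Positively Lagrange stable: $\{\varphi^h: h\ge0\}$ is precompact (relatively compact) in $C(\mathbb R,\mathfrak B)$. The $\omega$-limit set $\omega_\varphi$ is the set of all limits in $C(\mathbb R,\mathfrak B)$ of sequences $\varphi^{t_k}$ with $t_k\to+\infty$. A set $M$ is invariant if $\sigma(t,M)=M$ for all $t$; a minimal set is a nonempty closed invariant set with no proper nonempty closed invariant subset. A subset $A\subset\mathbb R$ is relatively dense if there is $l>0$ with $[a,a+l]\cap A\ne\emptyset$ for all $a\in\mathbb R$. A function $g\in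 C(\mathbb R,\mathfrak B)$ is positively remotely $\tau$-periodic ($\tau>0$) if $\lim_{t\to+\infty}|g(t+\tau)-g(t)|=0$; positively remotely stationary if this holds for every $\tau>0$; positively remotely almost periodic if for every $\varepsilon>0$ there is a relatively dense set $\mathcal P(\varepsilon)\subset\mathbb R$ such that for each $\tau\in\mathcal P(\varepsilon)$ there is $L(\varepsilon,\tau)>0$ with $|g(t+\tau)-g(t)|<\varepsilon$ for all $t\ge L(\varepsilon,\tau)$. *)

theory Defs
  imports "HOL-Analysis.Analysis"
begin

text \<open>
  The set of continuous functions is \<open>topspace compact_open\<close>, and the sets below form the
  standard subbasis of the compact-open topology.
\<close>

definition compact_open :: "('a::topological_space \<Rightarrow> 'b::topological_space) topology" where
  "compact_open = topology_generated_by
     {{f. continuous_on UNIV f \<and> f ` K \<subseteq> U} | K U. compact K \<and> open U}"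

lemma topspace_compact_open: "topspace compact_open = {f. continuous_on UNIV f}"
  unfolding compact_open_def topology_generated_by_topspace
  by (auto intro!: exI[of _ "{}"])

definition shift :: "real \<Rightarrow> (real \<Rightarrow> 'b) \<Rightarrow> real \<Rightarrow> 'b" where
  "shift h f = (\<lambda>t. f (t + h))"

definition positively_Lagrange_stable :: "(real \<Rightarrow> 'b::topological_space) \<Rightarrow> bool" where
  "positively_Lagrange_stable f \<longleftrightarrow>
     continuous_on UNIV f \<and> compactin compact_open (compact_open closure_of {shift h f | h. 0 \<le> h})"

definition omega_limit :: "(real \<Rightarrow> 'b::topological_space) \<Rightarrow> (real \<Rightarrow> 'b) set" where
  "omega_limit f =
     {g. \<exists>t :: nat \<Rightarrow> real. filterlim t at_top sequentially \<and>
           limitin compact_open (\<lambda>k. shift (t k) f) g sequentially}"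

definition shift_invariant :: "(real \<Rightarrow> 'b) set \<Rightarrow> bool" where
  "shift_invariant M \<longleftrightarrow> (\<forall>h. shift h ` M = M)"

definition minimal_set :: "(real \<Rightarrow> 'b::topological_space) set \<Rightarrow> bool" where
  "minimal_set M \<longleftrightarrow>
     M \<noteq> {} \<and> closedin compact_open M \<and> shift_invariant M \<and>
     \<not> (\<exists>N. N \<subset> M \<and> N \<noteq> {} \<and> closedin compact_open N \<and> shift_invariant N)"

definition relatively_dense :: "real set \<Rightarrow> bool" where
  "relatively_dense A \<longleftrightarrow> (\<exists>l>0. \<forall>a. {a..a + l} \<inter> A \<noteq> {})"

text \<open>The period is intended to be positive; this is required wherever the notion is used.\<close>

definition positively_remotely_periodic :: "real \<Rightarrow> (real \<Rightarrow> 'b::real_normed_vector) \<Rightarrow> bool" where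
  "positively_remotely_periodic \<tau> g \<longleftrightarrow>
     continuous_on UNIV g \<and> ((\<lambda>t. norm (g (t + \<tau>) - g t)) \<longlongrightarrow> 0) at_top"

definition positively_remotely_stationary :: "(real \<Rightarrow> 'b::real_normed_vector) \<Rightarrow> bool" where
  "positively_remotely_stationary g \<longleftrightarrow> (\<forall>\<tau>>0. positively_remotely_periodic \<tau> g)"

definition positively_remotely_almost_periodic :: "(real \<Rightarrow> 'b::real_normed_vector) \<Rightarrow> bool" where
  "positively_remotely_almost_periodic g \<longleftrightarrow>
     continuous_on UNIV g \<and>
     (\<forall>\<epsilon>>0. \<exists>P. relatively_dense P \<and>
        (\<forall>\<tau>\<in>P. \<exists>L>0. \<forall>t\<ge>L. norm (g (t + \<tau>) - g t) < \<epsilon>))"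

text \<open>
  The oriented integral from \<open>0\<close> to \<open>t\<close>. The Henstock-Kurzweil integral is used because, unlike
  the Bochner integral of the library, it needs no separability of the Banach space. Class
  \<open>banach\<close> also covers complex Banach spaces, by restriction of scalars; this changes neither
  the norm nor the integral.
\<close>

definition primitive :: "(real \<Rightarrow> 'b::banach) \<Rightarrow> real \<Rightarrow> 'b" where
  "primitive f t = (if 0 \<le> t then integral {0..t} f else - integral {t..0} f)"

end

theory Submission
  imports Defs
begin

text \<open>
  In the almost periodic case, fix \<open>g\<close> in the \<open>\<omega>\<close>-limit set, with primitive \<open>G\<close>. Every remote almost
  period of \<open>\<phi>\<close> is an almost period of \<open>g\<close> on the whole line, and \<open>G\<close> has relatively compact range. By
  the classical argument behind Bohr's theorem, with maximal separated sets in place of maxima of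
  real functions, almost periods of \<open>g\<close> are almost periods of \<open>G\<close>. By minimality the shifts of
  \<open>g\<close> are dense in the \<open>\<omega>\<close>-limit set, so \<open>\<phi>\<close> is eventually close to some shift of \<open>g\<close> on every
  window of a given length, and the estimate for \<open>G\<close> passes to \<open>F\<close>.
\<close>

section \<open>Compact-open topology and uniform convergence on compact sets\<close>

lemma openin_compact_open_subbasis:
  "compact K \<Longrightarrow> open U \<Longrightarrow> openin compact_open {f. continuous_on UNIV f \<and> f ` K \<subseteq> U}"
  unfolding compact_open_def by (rule topology_generated_by_Basis) blast

text \<open>By compactness, finitely many preimages of small balls under \<open>g\<close> cover
  \<open>K\<close>, and each gives one subbasic condition on \<open>f\<close>. The radii fit because
  e/3 + e/2 < e.\<close>

lemma compact_open_uniform_neighbourhood: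
  fixes g :: "'a::t2_space \<Rightarrow> 'b::metric_space"
  assumes g: "continuous_on UNIV g" and K: "compact K" and e: "e > 0"
  obtains V where "openin compact_open V" "g \<in> V" "\<And>f x. f \<in> V \<Longrightarrow> x \<in> K \<Longrightarrow> dist (f x) (g x) < e"
proof -
  have "open (g -` ball (g c) (e/3))" for c
    using g by (intro open_vimage) auto
  moreover have "K \<subseteq> (\<Union>c\<in>K. g -` ball (g c) (e/3))" using e by auto
  ultimately obtain C where C: "C \<subseteq> K" "finite C" "K \<subseteq> (\<Union>c\<in>C. g -` ball (g c) (e/3))"
    by (rule compactE_image[OF K]) auto
  \<comment> \<open>The closed ball makes this piece of \<open>K\<close> compact, as a subbasic set
    requires.\<close>
  define W where "W c = {f. continuous_on UNIV f \<and> f ` (K \<inter> g -` cball (g c) (e/3)) \<subseteq> ball (g c) (e/2)}" for c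
  have W: "openin compact_open (W c)" for c
    unfolding W_def using g K
    by (intro openin_compact_open_subbasis compact_Int_closed closed_vimage) auto
  have gW: "g \<in> W c" for c using e g unfolding W_def by auto
  \<comment> \<open>Intersecting with the whole space keeps \<open>?V\<close> open when
    \<open>C\<close> is empty.\<close>
  let ?V = "topspace compact_open \<inter> \<Inter>(W ` C)"
  have "openin compact_open ?V"
    using W C(2) by (cases "C = {}") (auto intro!: openin_Int)
  moreover have "g \<in> ?V" using gW g by (auto simp: topspace_compact_open)
  moreover have "dist (f x) (g x) < e" if f: "f \<in> ?V" and x: "x \<in> K" for f x
  proof -
    obtain c where c: "c \<in> C" "dist (g c) (g x) < e/3" using C(3) x by auto
    then have "f ` (K \<inter> g -` cball (g c) (e/3)) \<subseteq> ball (g c) (e/2)" using f by (auto simp: W_def)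
    moreover have "x \<in> K \<inter> g -` cball (g c) (e/3)" using c(2) x by simp
    ultimately have "f x \<in> ball (g c) (e/2)" by blast
    then have "dist (g c) (f x) < e/2" by simp
    with c(2) dist_triangle[of "f x" "g x" "g c"] e show ?thesis by (simp add: dist_commute)
  qed
  ultimately show ?thesis using that by blast
qed

lemma compact_open_limitin_imp_uniform:
  fixes g :: "'a::t2_space \<Rightarrow> 'b::metric_space"
  assumes lim: "limitin compact_open f g F" and "compact K" "e > 0"
  shows "\<forall>\<^sub>F n in F. \<forall>x\<in>K. dist (f n x) (g x) < e"
proof -
  have "continuous_on UNIV g" using limitin_topspace[OF lim] by (simp add: topspace_compact_open)
  then obtain V where V: "openin compact_open V" "g \<in> V"
      "\<And>f x. f \<in> V \<Longrightarrow> x \<in> K \<Longrightarrow> dist (f x) (g x) < e"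
    using compact_open_uniform_neighbourhood[OF _ assms(2,3)] by metis
  have "\<forall>\<^sub>F n in F. f n \<in> V" using lim V(1,2) unfolding limitin_def by blast
  then show ?thesis by (rule eventually_mono) (use V(3) in blast)
qed

text \<open>Converse of the previous lemma. Induction on the generation of the topology reduces it
  to a subbasic set, where the compact image of \<open>K\<close> under \<open>g\<close> has a whole
  \<open>e\<close>-neighbourhood inside the given open set.\<close>

lemma compact_open_limitinI:
  fixes g :: "'a::t2_space \<Rightarrow> 'b::metric_space"
  assumes g: "continuous_on UNIV g" and f: "\<And>n. continuous_on UNIV (f n)"
    and unif: "\<And>K e. compact K \<Longrightarrow> e > 0 \<Longrightarrow> \<forall>\<^sub>F n in F. \<forall>x\<in>K. dist (f n x) (g x) < e"
  shows "limitin compact_open f g F"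
  unfolding limitin_def
proof (intro conjI allI impI)
  show "g \<in> topspace compact_open" using g by (simp add: topspace_compact_open)
  fix U assume U: "openin compact_open U \<and> g \<in> U"
  then have "generate_topology_on {{f. continuous_on UNIV f \<and> f ` K \<subseteq> U} | K U. compact K \<and> open U} U"
    by (simp only: compact_open_def openin_topology_generated_by_iff)
  then have "g \<in> U \<longrightarrow> (\<forall>\<^sub>F n in F. f n \<in> U)"
  proof induction
    case (Int a b) then show ?case by (auto intro: eventually_conj)
  next
    case (UN K)
    show ?case
    proof
      assume "g \<in> \<Union>K"
      then obtain k where k: "k \<in> K" "g \<in> k" by blast
      then have "\<forall>\<^sub>F n in F. f n \<in> k" using UN by blast
      then show "\<forall>\<^sub>F n in F. f n \<in> \<Union>K" by (rule eventually_mono) (use k in blast)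
    qed
  next
    case (Basis s)
    then obtain K V where s: "s = {f. continuous_on UNIV f \<and> f ` K \<subseteq> V}" "compact K" "open V" by blast
    show ?case
    proof
      assume "g \<in> s"
      then have "compact (g ` K)" "g ` K \<subseteq> V"
        using s g by (auto intro: compact_continuous_image continuous_on_subset)
      then obtain e where e: "e > 0" "(\<Union>y\<in>g ` K. cball y e) \<subseteq> V"
        using compact_subset_open_imp_cball_epsilon_subset s(3) by metis
      have "\<forall>\<^sub>F n in F. \<forall>x\<in>K. dist (f n x) (g x) < e" using unif s(2) e(1) by blast
      then show "\<forall>\<^sub>F n in F. f n \<in> s"
      proof (rule eventually_mono)
        fix n assume "\<forall>x\<in>K. dist (f n x) (g x) < e"
        then have "f n ` K \<subseteq> V" using e(2) by (fastforce simp: dist_commute)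
        then show "f n \<in> s" using s f by auto
      qed
    qed
  qed auto
  with U show "\<forall>\<^sub>F n in F. f n \<in> U" by blast
qed

section \<open>Shifts, orbit closures and minimal sets\<close>

lemma shift_shift: "shift a (shift b f) = shift (a + b) f"
  by (simp add: shift_def add.assoc)

lemma shift_0 [simp]: "shift 0 f = f"
  by (simp add: shift_def)

lemma continuous_on_shift: "continuous_on UNIV f \<Longrightarrow> continuous_on UNIV (shift h f)"
  unfolding shift_def
  by (rule continuous_on_compose2[of UNIV f UNIV "\<lambda>t. t + h"]) (auto intro: continuous_intros)

lemma continuous_map_into_compact_open:
  fixes f :: "'c \<Rightarrow> 'a::topological_space \<Rightarrow> 'b::topological_space"
  assumes f: "f ` topspace X \<subseteq> topspace compact_open"
    and "\<And>K U. compact K \<Longrightarrow> open U \<Longrightarrow> openin X {x \<in> topspace X. f x ` K \<subseteq> U}"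
  shows "continuous_map X compact_open f"
  unfolding compact_open_def
proof (rule continuous_on_generated_topo)
  fix S :: "('a \<Rightarrow> 'b) set"
  assume "S \<in> {{f. continuous_on UNIV f \<and> f ` K \<subseteq> U} | K U. compact K \<and> open U}"
  then obtain K U where S: "S = {f. continuous_on UNIV f \<and> f ` K \<subseteq> U}" "compact K" "open U" by blast
  have "f -` S \<inter> topspace X = {x \<in> topspace X. f x ` K \<subseteq> U}"
    using f unfolding S(1) topspace_compact_open by blast
  then show "openin X (f -` S \<inter> topspace X)" using assms(2)[OF S(2,3)] by simp
next
  show "f ` topspace X \<subseteq> \<Union>{{f :: 'a \<Rightarrow> 'b. continuous_on UNIV f \<and> f ` K \<subseteq> U} | K U. compact K \<and> open U}"
    using f by (simp only: compact_open_def topology_generated_by_topspace)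
qed

lemma continuous_map_shift: "continuous_map compact_open compact_open (shift h)"
proof (rule continuous_map_into_compact_open)
  show "shift h ` topspace compact_open \<subseteq> topspace compact_open"
    by (auto simp: topspace_compact_open continuous_on_shift)
  fix K :: "real set" and U :: "'a set"
  assume K: "compact K" "open U"
  have "{f \<in> topspace compact_open. shift h f ` K \<subseteq> U} =
      {f. continuous_on UNIV f \<and> f ` ((\<lambda>x. h + x) ` K) \<subseteq> U}"
    by (simp add: topspace_compact_open shift_def image_subset_iff add.commute)
  moreover have "openin compact_open {f. continuous_on UNIV f \<and> f ` ((\<lambda>x. h + x) ` K) \<subseteq> U}"
    by (rule openin_compact_open_subbasis[OF compact_translation[OF K(1)] K(2)])
  ultimately show "openin compact_open {f \<in> topspace compact_open. shift h f ` K \<subseteq> U}" by simp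
qed

text \<open>Each shift is continuous, so it maps the orbit closure into itself; equality follows
  because \<open>shift (- h)\<close> inverts \<open>shift h\<close>.\<close>

lemma shift_invariant_orbit_closure:
  "shift_invariant (compact_open closure_of (range (\<lambda>h. shift h f)))" (is "shift_invariant ?C")
proof -
  have sub: "shift h ` ?C \<subseteq> ?C" for h
  proof -
    have "shift h ` range (\<lambda>h. shift h f) \<subseteq> range (\<lambda>h. shift h f)" by (auto simp: shift_shift)
    then show ?thesis
      by (rule order_trans[OF continuous_map_image_closure_subset[OF continuous_map_shift] closure_of_mono])
  qed
  show ?thesis unfolding shift_invariant_def
  proof (intro allI equalityI sub)
    fix h
    show "?C \<subseteq> shift h ` ?C"
    proof
      fix g assume "g \<in> ?C"
      then have "shift (- h) g \<in> ?C" using sub by blast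
      moreover have "g = shift h (shift (- h) g)" by (simp add: shift_shift)
      ultimately show "g \<in> shift h ` ?C" by (rule image_eqI[of _ "shift h" "shift (- h) g", rotated])
    qed
  qed
qed

text \<open>The orbit closure is itself a nonempty closed invariant subset of \<open>M\<close>, so
  by minimality it cannot be proper.\<close>

lemma minimal_set_orbit_dense:
  assumes "minimal_set M" and f: "f \<in> M"
  shows "compact_open closure_of (range (\<lambda>h. shift h f)) = M"
proof -
  have M: "closedin compact_open M" "shift_invariant M"
    and min: "\<And>N. N \<subset> M \<Longrightarrow> N \<noteq> {} \<Longrightarrow> closedin compact_open N \<Longrightarrow> \<not> shift_invariant N"
    using assms unfolding minimal_set_def by blast+
  let ?C = "compact_open closure_of (range (\<lambda>h. shift h f))"
  have orb: "range (\<lambda>h. shift h f) \<subseteq> M" using M(2) f unfolding shift_invariant_def by blast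
  then have "?C \<subseteq> M" using M(1) by (rule closure_of_minimal)
  moreover have "f \<in> ?C"
  proof -
    have "range (\<lambda>h. shift h f) \<subseteq> ?C" using orb M(1) closedin_subset by (intro closure_of_subset) auto
    moreover have "f = shift 0 f" by simp
    ultimately show ?thesis by blast
  qed
  ultimately show ?thesis
    using min[of ?C] shift_invariant_orbit_closure closedin_closure_of by blast
qed

section \<open>Lagrange stability and proximity to the omega-limit set\<close>

text \<open>Compactness by covers gives a cluster point \<open>g\<close> of the sequence; closeness
  on growing windows with shrinking tolerance turns it into a limit. The indices \<open>n j\<close>
  need not increase: \<open>j \<le> n j\<close> is enough for \<open>t (n j)\<close> to tend to
  infinity.\<close>

lemma positively_Lagrange_stable_subsequence:
  fixes f :: "real \<Rightarrow> 'b::metric_space"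
  assumes st: "positively_Lagrange_stable f" and t: "\<And>k. real k \<le> t k"
  obtains g n where "\<And>j. j \<le> n j" "limitin compact_open (\<lambda>j. shift (t (n j)) f) g sequentially"
proof -
  have f: "continuous_on UNIV f"
    and C: "compactin compact_open (compact_open closure_of {shift h f | h. 0 \<le> h})" (is "compactin _ ?C")
    using st by (auto simp: positively_Lagrange_stable_def)
  have orb: "{shift h f | h. 0 \<le> h} \<subseteq> ?C"
    by (rule closure_of_subset) (auto simp: topspace_compact_open continuous_on_shift f)
  have tC: "shift (t k) f \<in> ?C" for k using orb t[of k] by force
  \<comment> \<open>These are the open sets that the sequence eventually avoids. A finite subfamily
    covering \<open>?C\<close> would be avoided as a whole by some term, yet every term lies in
    \<open>?C\<close>. A point outside their union is a cluster point.\<close>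
  define \<U> where "\<U> = {V. openin compact_open V \<and> (\<exists>k. \<forall>n\<ge>k. shift (t n) f \<notin> V)}"
  have "\<not> ?C \<subseteq> \<Union>\<U>"
  proof
    assume "?C \<subseteq> \<Union>\<U>"
    then obtain \<F> where F: "finite \<F>" "\<F> \<subseteq> \<U>" "?C \<subseteq> \<Union>\<F>"
      using compactinD[OF C, of \<U>] by (auto simp: \<U>_def)
    then have "\<forall>V\<in>\<F>. \<forall>\<^sub>F n in sequentially. shift (t n) f \<notin> V"
      by (auto simp: \<U>_def eventually_sequentially)
    then have "\<forall>\<^sub>F n in sequentially. \<forall>V\<in>\<F>. shift (t n) f \<notin> V"
      using F(1) by (simp add: eventually_ball_finite)
    then obtain n where "\<forall>V\<in>\<F>. shift (t n) f \<notin> V" by (auto simp: eventually_sequentially)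
    then show False using tC F(3) by blast
  qed
  then obtain g where gC: "g \<in> ?C" and gU: "g \<notin> \<Union>\<U>" by blast
  have freq: "\<exists>n\<ge>k. shift (t n) f \<in> V" if "openin compact_open V" "g \<in> V" for V k
    using that gU unfolding \<U>_def by blast
  have g: "continuous_on UNIV g"
    using gC by (simp add: in_closure_of topspace_compact_open)
  \<comment> \<open>Every compact set lies in [-j, j] for large \<open>j\<close>, so this single
    diagonal choice serves all compact sets.\<close>
  have "\<exists>n\<ge>j. \<forall>x\<in>{- real j..real j}. dist (shift (t n) f x) (g x) < inverse (real (Suc j))" for j
  proof -
    have "0 < inverse (real (Suc j))" by simp
    from compact_open_uniform_neighbourhood[OF g compact_Icc this]
    obtain V where V: "openin compact_open V" "g \<in> V"
      "\<And>f x. f \<in> V \<Longrightarrow> x \<in> {- real j..real j} \<Longrightarrow> dist (f x) (g x) < inverse (real (Suc j))"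
      by blast
    then show ?thesis using freq[OF V(1,2)] by blast
  qed
  then obtain n where n: "\<And>j. j \<le> n j"
      "\<And>j x. x \<in> {- real j..real j} \<Longrightarrow> dist (shift (t (n j)) f x) (g x) < inverse (real (Suc j))"
    by metis
  have "limitin compact_open (\<lambda>j. shift (t (n j)) f) g sequentially"
  proof (rule compact_open_limitinI[OF g continuous_on_shift[OF f]])
    fix K :: "real set" and e :: real
    assume K: "compact K" and e: "e > 0"
    obtain B where B: "\<And>x. x \<in> K \<Longrightarrow> \<bar>x\<bar> \<le> B"
      using compact_imp_bounded[OF K] by (auto simp: bounded_iff)
    have "\<forall>\<^sub>F j in sequentially. B \<le> real j"
      using filterlim_real_sequentially by (simp add: filterlim_at_top)
    moreover have "\<forall>\<^sub>F j in sequentially. inverse (real (Suc j)) < e"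
      using order_tendstoD(2)[OF LIMSEQ_inverse_real_of_nat e] .
    ultimately show "\<forall>\<^sub>F j in sequentially. \<forall>x\<in>K. dist (shift (t (n j)) f x) (g x) < e"
    proof eventually_elim
      case (elim j)
      show ?case
      proof
        fix x assume "x \<in> K"
        then have "x \<in> {- real j..real j}" using B[of x] elim(1) by auto
        then show "dist (shift (t (n j)) f x) (g x) < e" using n(2) elim(2) less_trans by blast
      qed
    qed
  qed
  then show ?thesis using that n(1) by blast
qed

text \<open>Failure along times tending to infinity would, after extraction, give a limit
  \<open>p\<close> in the omega-limit set. The orbit of \<open>g\<close> is dense there by
  minimality, so some shift of \<open>g\<close> is within \<open>e/2\<close> of \<open>p\<close> on
  the window, and so is a late extracted shift of \<open>f\<close>.\<close>

lemma eventually_near_orbit: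
  fixes f :: "real \<Rightarrow> 'b::metric_space"
  assumes st: "positively_Lagrange_stable f" and min: "minimal_set (omega_limit f)"
    and g: "g \<in> omega_limit f" and e: "e > 0"
  shows "\<forall>\<^sub>F h in at_top. \<exists>h'. \<forall>s. \<bar>s\<bar> \<le> R \<longrightarrow> dist (f (s + h)) (g (s + h')) < e"
proof (rule ccontr)
  assume "\<not> ?thesis"
  then have "\<exists>h\<ge>real k. \<forall>h'. \<exists>s. \<bar>s\<bar> \<le> R \<and> \<not> dist (f (s + h)) (g (s + h')) < e" for k
    by (auto simp: eventually_at_top_linorder)
  then obtain t where t: "\<And>k. real k \<le> t k"
      and far: "\<And>k h'. \<exists>s. \<bar>s\<bar> \<le> R \<and> \<not> dist (f (s + t k)) (g (s + h')) < e"
    by metis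
  obtain p n where n: "\<And>j. j \<le> n j"
    and lim: "limitin compact_open (\<lambda>j. shift (t (n j)) f) p sequentially"
    using positively_Lagrange_stable_subsequence[OF st t] by blast
  have "filterlim (\<lambda>j. t (n j)) at_top sequentially"
  proof (rule filterlim_at_top_mono[OF filterlim_real_sequentially], rule always_eventually, rule allI)
    show "real j \<le> t (n j)" for j using t[of "n j"] n[of j] by linarith
  qed
  then have "p \<in> omega_limit f" using lim by (auto simp: omega_limit_def)
  then have p: "p \<in> compact_open closure_of (range (\<lambda>h. shift h g))"
    using minimal_set_orbit_dense[OF min g] by simp
  then have "continuous_on UNIV p"
    by (simp add: in_closure_of topspace_compact_open)
  then obtain V where V: "openin compact_open V" "p \<in> V"
      "\<And>f x. f \<in> V \<Longrightarrow> x \<in> {-R..R} \<Longrightarrow> dist (f x) (p x) < e/2"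
    using compact_open_uniform_neighbourhood[OF _ compact_Icc half_gt_zero[OF e]] by blast
  then obtain h' where h': "shift h' g \<in> V" using p by (auto simp: in_closure_of)
  have "\<forall>\<^sub>F j in sequentially. \<forall>x\<in>{-R..R}. dist (shift (t (n j)) f x) (p x) < e/2"
    using compact_open_limitin_imp_uniform[OF lim compact_Icc half_gt_zero[OF e]] .
  then obtain j where j: "\<forall>x\<in>{-R..R}. dist (shift (t (n j)) f x) (p x) < e/2"
    by (auto simp: eventually_sequentially)
  obtain s where s: "\<bar>s\<bar> \<le> R" "\<not> dist (f (s + t (n j))) (g (s + h')) < e" using far by blast
  have "dist (f (s + t (n j))) (p s) < e/2" "dist (g (s + h')) (p s) < e/2"
    using j V(3)[OF h', of s] s(1) by (auto simp: shift_def abs_le_iff)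
  then show False using s(2) dist_triangle_half_l by blast
qed

section \<open>Mean value estimates and the primitive\<close>

text \<open>Later estimates of integrals are obtained by differentiating and applying this mean
  value inequality. No order is imposed on \<open>a\<close> and \<open>b\<close>, so negative
  increments are covered.\<close>

lemma vector_derivative_bound:
  fixes f :: "real \<Rightarrow> 'b::real_normed_vector"
  assumes d: "\<And>x. (f has_vector_derivative f' x) (at x)"
    and B: "\<And>x. x \<in> closed_segment a b \<Longrightarrow> norm (f' x) \<le> B"
  shows "norm (f b - f a) \<le> B * \<bar>b - a\<bar>"
proof -
  have "norm (f b - f a) \<le> B * norm (b - a)"
  proof (rule differentiable_bound)
    show "convex (closed_segment a b)" by simp
    show "(f has_derivative (\<lambda>h. h *\<^sub>R f' x)) (at x within closed_segment a b)" for x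
      using d[of x] by (auto simp: has_vector_derivative_def intro: has_derivative_at_withinI)
    show "onorm (\<lambda>h. h *\<^sub>R f' x) \<le> B" if "x \<in> closed_segment a b" for x
    proof (rule onorm_le)
      show "norm (h *\<^sub>R f' x) \<le> B * norm h" for h
        using mult_right_mono[OF B[OF that], of "\<bar>h\<bar>"] by (simp add: mult.commute)
    qed
  qed auto
  then show ?thesis by simp
qed

lemma has_vector_derivative_translate:
  fixes f :: "real \<Rightarrow> 'b::real_normed_vector"
  assumes "\<And>x. (f has_vector_derivative f' x) (at x)"
  shows "((\<lambda>x. f (x + c)) has_vector_derivative f' (x + c)) (at x)"
proof -
  have "((\<lambda>x. x + c) has_vector_derivative 1) (at x)" by (auto intro!: derivative_eq_intros)
  from vector_diff_chain_at[OF this assms] show ?thesis by (simp add: o_def)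
qed

lemma primitive_has_vector_derivative:
  fixes f :: "real \<Rightarrow> 'b::banach"
  assumes f: "continuous_on UNIV f"
  shows "(primitive f has_vector_derivative f t) (at t)"
proof -
  \<comment> \<open>This base point lies to the left of 0 and \<open>t\<close>, so near
    \<open>t\<close> both branches of \<open>primitive\<close> become one integral from
    \<open>a\<close>, up to a constant.\<close>
  define a where "a = - \<bar>t\<bar> - 1"
  have c: "continuous_on S f" for S using f continuous_on_subset by blast
  have int: "f integrable_on {x..y}" for x y by (rule integrable_continuous_real[OF c])
  have eq: "primitive f s = integral {a..s} f - integral {a..0} f" if s: "s \<in> {a<..< -a}" for s
  proof (cases "0 \<le> s")
    case True
    have "integral {a..0} f + integral {0..s} f = integral {a..s} f"
      using True by (intro Henstock_Kurzweil_Integration.integral_combine int) (auto simp: a_def)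
    then show ?thesis using True by (simp add: primitive_def algebra_simps)
  next
    case False
    have "integral {a..s} f + integral {s..0} f = integral {a..0} f"
      using False s by (intro Henstock_Kurzweil_Integration.integral_combine int) auto
    then show ?thesis using False by (simp add: primitive_def algebra_simps)
  qed
  have t: "t \<in> {a<..< -a}" by (auto simp: a_def)
  have "((\<lambda>u. integral {a..u} f) has_vector_derivative f t) (at t within {a<..< -a})"
    by (rule has_vector_derivative_within_subset[OF integral_has_vector_derivative[OF c, where b = "-a"]]) (use t in auto)
  then have "((\<lambda>u. integral {a..u} f - integral {a..0} f) has_vector_derivative f t) (at t)"
    unfolding at_within_open[OF t open_greaterThanLessThan]
    by (simp add: has_vector_derivative_diff_const)
  then show ?thesis
    by (rule has_vector_derivative_transform_within_open[OF _ open_greaterThanLessThan t]) (rule eq[symmetric])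
qed

lemma continuous_on_primitive:
  "continuous_on UNIV f \<Longrightarrow> continuous_on UNIV (primitive f)"
  by (meson primitive_has_vector_derivative has_vector_derivative_continuous continuous_at_imp_continuous_on)

section \<open>Almost periods of a primitive with relatively compact range\<close>

text \<open>Total boundedness limits the size of \<open>e\<close>-separated index sets, so
  \<open>T\<close> can be taken of greatest size. A map \<open>p\<close> that keeps \<open>T\<close>
  separated is injective on it, so the image is again of greatest size and no further value can be
  far from it.\<close>

lemma maximal_separated_net:
  fixes F :: "'i \<Rightarrow> 'b::metric_space"
  assumes D: "compact D" "range F \<subseteq> D" and e: "e > 0"
  obtains T where "finite T" "pairwise (\<lambda>i j. e < dist (F i) (F j)) T"
    "\<And>p t. pairwise (\<lambda>i j. e < dist (F (p i)) (F (p j))) T \<Longrightarrow> \<exists>i\<in>T. dist (F t) (F (p i)) \<le> e"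
proof -
  define sep where "sep T \<longleftrightarrow> finite T \<and> pairwise (\<lambda>i j. e < dist (F i) (F j)) T" for T
  obtain C where C: "finite C" "D \<subseteq> (\<Union>x\<in>C. ball x (e/2))"
    using D(1) e compact_imp_seq_compact seq_compact_imp_totally_bounded by (metis half_gt_zero)
  \<comment> \<open>Separated values lie in different balls of radius \<open>e/2\<close>, so the
    cover bounds their number.\<close>
  have "card T < Suc (card C)" if "sep T" for T
  proof -
    have "\<forall>i. \<exists>x\<in>C. dist x (F i) < e/2" using C(2) D(2) by fastforce
    then obtain c where c: "\<And>i. c i \<in> C" "\<And>i. dist (c i) (F i) < e/2" by metis
    have "inj_on c T"
    proof (rule inj_onI, rule ccontr)
      fix i j assume ij: "i \<in> T" "j \<in> T" "c i = c j" "i \<noteq> j"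
      then have "e < dist (F i) (F j)" using that by (auto simp: sep_def pairwise_def)
      then show False
        using c(2)[of i, unfolded ij(3)] c(2)[of j] dist_triangle3[of "F i" "F j" "c j"] by linarith
    qed
    then have "card T \<le> card C" using c(1) C(1) by (intro card_inj_on_le) auto
    then show ?thesis by simp
  qed
  moreover have "sep {}" by (simp add: sep_def)
  ultimately obtain T where T: "sep T" "\<And>S. sep S \<Longrightarrow> card S \<le> card T"
    using Lattices_Big.ex_has_greatest_nat[of sep "{}" card] by blast
  have "\<exists>i\<in>T. dist (F t) (F (p i)) \<le> e"
    if p: "pairwise (\<lambda>i j. e < dist (F (p i)) (F (p j))) T" for p t
  proof (rule ccontr)
    assume "\<not> ?thesis"
    then have far: "\<And>i. i \<in> T \<Longrightarrow> e < dist (F t) (F (p i))" by force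
    have "sep (insert t (p ` T))"
      using T(1) p far by (fastforce simp: sep_def pairwise_def dist_commute)
    moreover have "inj_on p T"
    proof (rule inj_onI, rule ccontr)
      fix i j assume ij: "i \<in> T" "j \<in> T" "p i = p j" "i \<noteq> j"
      have "e < dist (F (p i)) (F (p j))" by (rule pairwiseD[OF p ij(1,2,4)])
      then show False using ij e by simp
    qed
    moreover have "t \<notin> p ` T" using far e by fastforce
    ultimately show False
      using T by (metis card_image card_insert_disjoint finite_imageI not_less_eq_eq order_refl sep_def)
  qed
  then show ?thesis using that T(1) by (auto simp: sep_def)
qed

text \<open>Unlike a remote almost period, this is required on the whole line. The inequality is not
  strict because it will arise as a limit.\<close>

definition almost_period :: "(real \<Rightarrow> 'b::real_normed_vector) \<Rightarrow> real \<Rightarrow> real \<Rightarrow> bool" where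
  "almost_period g \<delta> \<tau> \<longleftrightarrow> (\<forall>t. norm (g (t + \<tau>) - g t) \<le> \<delta>)"

text \<open>The increment of \<open>G\<close> over \<open>\<tau>\<close> has derivative
  \<open>g (x + \<tau>) - g x\<close>, so it is Lipschitz with constant
  \<open>\<delta>\<close>.\<close>

lemma almost_period_increment_bound:
  fixes G :: "real \<Rightarrow> 'b::real_normed_vector"
  assumes d: "\<And>x. (G has_vector_derivative g x) (at x)" and "almost_period g \<delta> \<tau>"
  shows "norm ((G (s + \<tau>) - G s) - (G (t + \<tau>) - G t)) \<le> \<delta> * \<bar>s - t\<bar>"
proof (rule vector_derivative_bound)
  show "((\<lambda>x. G (x + \<tau>) - G x) has_vector_derivative g (x + \<tau>) - g x) (at x)" for x
    by (rule has_vector_derivative_diff[OF has_vector_derivative_translate[OF d] d])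
  show "norm (g (x + \<tau>) - g x) \<le> \<delta>" for x
    using assms(2) by (simp add: almost_period_def)
qed

text \<open>A maximal separated set of values is attained on a bounded window. Translating the window by
  an almost period of \<open>g\<close> keeps these values separated, hence still maximal.\<close>

lemma primitive_window_net:
  fixes G :: "real \<Rightarrow> 'b::real_normed_vector"
  assumes d: "\<And>x. (G has_vector_derivative g x) (at x)"
    and ap: "\<And>\<delta>. \<delta> > 0 \<Longrightarrow> \<exists>P. relatively_dense P \<and> (\<forall>\<tau>\<in>P. almost_period g \<delta> \<tau>)"
    and D: "compact D" "range G \<subseteq> D" and e: "e > 0"
  obtains L where "L > 0" "\<And>a t. \<exists>s\<in>{a..a + L}. dist (G t) (G s) \<le> e"
proof -
  obtain T where T: "finite T" "pairwise (\<lambda>i j. e < dist (G i) (G j)) T"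
    and net: "\<And>p t. pairwise (\<lambda>i j. e < dist (G (p i)) (G (p j))) T \<Longrightarrow> \<exists>i\<in>T. dist (G t) (G (p i)) \<le> e"
    using maximal_separated_net[OF D e] by blast
  obtain R where R: "R > 0" "\<And>i. i \<in> T \<Longrightarrow> \<bar>i\<bar> \<le> R"
    using finite_imp_bounded[OF T(1)] by (auto simp: bounded_pos)
  \<comment> \<open>Finitely many distances exceed \<open>e\<close> strictly, hence by a common
    margin \<open>\<eta>\<close>; the 1 keeps the set nonempty when \<open>T\<close> has fewer than
    two points.\<close>
  let ?E = "insert 1 ((\<lambda>(i, j). dist (G i) (G j) - e) ` {(i, j) \<in> T \<times> T. i \<noteq> j})"
  have "finite {(i, j) \<in> T \<times> T. i \<noteq> j}"
    by (rule finite_subset[of _ "T \<times> T"]) (use T(1) in auto)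
  then have fin: "finite ?E" by simp
  define \<eta> where "\<eta> = Min ?E"
  have \<eta>: "\<eta> > 0" unfolding \<eta>_def using fin T(2) by (subst Min_gr_iff) (auto simp: pairwise_def)
  have sep: "e + \<eta> \<le> dist (G i) (G j)" if "i \<in> T" "j \<in> T" "i \<noteq> j" for i j
  proof -
    have "dist (G i) (G j) - e \<in> ?E" using that by (intro insertI2 image_eqI[of _ _ "(i, j)"]) auto
    then have "\<eta> \<le> dist (G i) (G j) - e" unfolding \<eta>_def using fin by (rule Min_le[rotated])
    then show ?thesis by simp
  qed
  \<comment> \<open>Points of \<open>T\<close> are at most \<open>2 * R\<close> apart, so
    translation by a \<open>\<delta>\<close>-almost period changes a difference of two values of
    \<open>G\<close> by at most \<open>\<eta> / 2\<close>.\<close>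
  define \<delta> where "\<delta> = \<eta> / (4 * R)"
  have \<delta>: "\<delta> > 0" using \<eta> R by (simp add: \<delta>_def)
  then obtain P where P: "relatively_dense P" "\<And>\<tau>. \<tau> \<in> P \<Longrightarrow> almost_period g \<delta> \<tau>" using ap by blast
  then obtain l where l: "l > 0" "\<And>a. {a..a + l} \<inter> P \<noteq> {}" by (auto simp: relatively_dense_def)
  have "\<exists>s\<in>{a..a + (2 * R + l)}. dist (G t) (G s) \<le> e" for a t
  proof -
    \<comment> \<open>As \<open>T\<close> lies in [-R, R], its translate by this
      \<open>\<tau>\<close> lies in the window starting at \<open>a\<close>.\<close>
    obtain \<tau> where \<tau>: "\<tau> \<in> P" "a + R \<le> \<tau>" "\<tau> \<le> a + R + l" using l(2)[of "a + R"] by auto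
    have "pairwise (\<lambda>i j. e < dist (G (i + \<tau>)) (G (j + \<tau>))) T"
    proof (rule pairwiseI)
      fix i j assume ij: "i \<in> T" "j \<in> T" "i \<noteq> j"
      have "norm ((G (i + \<tau>) - G i) - (G (j + \<tau>) - G j)) \<le> \<delta> * \<bar>i - j\<bar>"
        using almost_period_increment_bound[OF d P(2)[OF \<tau>(1)]] .
      also have "\<dots> \<le> \<delta> * (2 * R)" using R(2)[OF ij(1)] R(2)[OF ij(2)] \<delta> by (intro mult_left_mono) auto
      also have "\<dots> < \<eta>" using R \<eta> by (simp add: \<delta>_def)
      finally have *: "norm ((G i - G j) - (G (i + \<tau>) - G (j + \<tau>))) < \<eta>"
        by (simp add: norm_minus_commute algebra_simps)
      have "norm (G i - G j) - norm (G (i + \<tau>) - G (j + \<tau>)) < \<eta>"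
        using norm_triangle_ineq2 * by (rule le_less_trans)
      then show "e < dist (G (i + \<tau>)) (G (j + \<tau>))" using sep[OF ij] by (simp add: dist_norm)
    qed
    then obtain i where "i \<in> T" "dist (G t) (G (i + \<tau>)) \<le> e"
      using net[of "\<lambda>i. i + \<tau>" t] by blast
    moreover have "i + \<tau> \<in> {a..a + (2 * R + l)}" using \<tau> R(2)[OF \<open>i \<in> T\<close>] by auto
    ultimately show ?thesis by blast
  qed
  then show ?thesis using that[of "2 * R + l"] R l by simp
qed

text \<open>Up to the stated error, the range of \<open>G\<close> is mapped into itself by the translation by
  \<open>v = G (a + \<tau>) - G a\<close>. Iterating this and using that the range is bounded bounds \<open>v\<close>.\<close>

lemma primitive_almost_period:
  fixes G :: "real \<Rightarrow> 'b::real_normed_vector"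
  assumes d: "\<And>x. (G has_vector_derivative g x) (at x)"
    and net: "\<And>a t. \<exists>s\<in>{a..a + L}. dist (G t) (G s) \<le> e"
    and bdd: "bounded (range G)" and \<tau>: "almost_period g \<delta> \<tau>"
  shows "almost_period G (e + \<delta> * L) \<tau>"
  unfolding almost_period_def
proof
  fix a
  define v where "v = G (a + \<tau>) - G a"
  define c where "c = e + \<delta> * L"
  obtain B where B: "\<And>t. norm (G t) \<le> B" using bdd by (auto simp: bounded_iff)
  have \<delta>: "\<delta> \<ge> 0" 
    using \<tau> unfolding almost_period_def by (meson norm_ge_zero order_trans)
  \<comment> \<open>Pick \<open>s\<close> in the window with \<open>G s\<close> near
    \<open>G t\<close>; there the increment over \<open>\<tau>\<close> differs from \<open>v\<close>
    by at most \<open>\<delta> * L\<close>.\<close>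
  have step: "\<exists>s. norm (G s - G t - v) \<le> c" for t
  proof -
    obtain s where s: "s \<in> {a..a + L}" "dist (G t) (G s) \<le> e" using net by blast
    have "norm ((G (s + \<tau>) - G s) - v) \<le> \<delta> * \<bar>s - a\<bar>"
      unfolding v_def using almost_period_increment_bound[OF d \<tau>] .
    also have "\<dots> \<le> \<delta> * L" using s \<delta> by (intro mult_left_mono) auto
    finally have "norm ((G s - G t) + (G (s + \<tau>) - G s - v)) \<le> e + \<delta> * L"
      using s(2) by (intro norm_triangle_le add_mono) (simp_all add: dist_norm norm_minus_commute)
    moreover have "(G s - G t) + (G (s + \<tau>) - G s - v) = G (s + \<tau>) - G t - v" by simp
    ultimately show ?thesis by (intro exI[of _ "s + \<tau>"]) (simp only: c_def)
  qed
  have iter: "\<exists>s. norm (G s - G a - real k *\<^sub>R v) \<le> real k * c" for k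
  proof (induction k)
    case 0 show ?case by (intro exI[of _ a]) simp
  next
    case (Suc k)
    then obtain s where s: "norm (G s - G a - real k *\<^sub>R v) \<le> real k * c" by blast
    obtain s' where s': "norm (G s' - G s - v) \<le> c" using step by blast
    have "norm ((G s' - G s - v) + (G s - G a - real k *\<^sub>R v)) \<le> c + real k * c"
      using s s' by (intro norm_triangle_le add_mono)
    then show ?case by (intro exI[of _ s']) (simp add: algebra_simps)
  qed
  have bound: "real k * (norm v - c) \<le> 2 * B" for k
  proof -
    obtain s where s: "norm (G s - G a - real k *\<^sub>R v) \<le> real k * c" using iter by blast
    have "real k * norm v = norm ((G s - G a) - (G s - G a - real k *\<^sub>R v))" by simp
    also have "\<dots> \<le> norm (G s - G a) + real k * c" by (rule norm_triangle_le_diff[OF add_left_mono[OF s]])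
    also have "norm (G s - G a) \<le> 2 * B" using B[of s] B[of a] by (intro norm_triangle_le_diff) simp
    finally show ?thesis by (simp add: algebra_simps)
  qed
  show "norm (G (a + \<tau>) - G a) \<le> e + \<delta> * L"
  proof (rule ccontr)
    assume "\<not> ?thesis"
    then have "norm v - c > 0" by (simp add: v_def c_def)
    then obtain k where "2 * B < real k * (norm v - c)" using reals_Archimedean3 by blast
    then show False using bound[of k] by simp
  qed
qed

section \<open>Passage between a function and its omega-limit set\<close>

lemma omega_limit_pointwise:
  fixes f :: "real \<Rightarrow> 'b::metric_space"
  assumes "g \<in> omega_limit f"
  obtains t where "filterlim t at_top sequentially" "continuous_on UNIV g"
    "\<forall>R. \<forall>e>0. \<forall>\<^sub>F k in sequentially. \<forall>x. \<bar>x\<bar> \<le> R \<longrightarrow> dist (f (x + t k)) (g x) < e"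
proof -
  obtain t where t: "filterlim t at_top sequentially"
    "limitin compact_open (\<lambda>k. shift (t k) f) g sequentially"
    using assms unfolding omega_limit_def by blast
  have near: "\<forall>\<^sub>F k in sequentially. \<forall>x. \<bar>x\<bar> \<le> R \<longrightarrow> dist (f (x + t k)) (g x) < e" if "e > 0" for R e
    using compact_open_limitin_imp_uniform[OF t(2) compact_Icc that, of "- R" R]
    by (rule eventually_mono) (auto simp: shift_def abs_le_iff)
  have "continuous_on UNIV g" using limitin_topspace[OF t(2)] by (simp add: topspace_compact_open)
  then show ?thesis using near by (intro that[OF t(1)] allI impI)
qed

text \<open>For fixed \<open>x\<close> the times \<open>x + t k\<close> eventually pass
  \<open>L\<close>, where the remote estimate holds; letting \<open>k\<close> tend to infinity
  carries it to \<open>g\<close> at \<open>x\<close>.\<close>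

lemma omega_limit_almost_period:
  fixes f :: "real \<Rightarrow> 'b::real_normed_vector"
  assumes g: "g \<in> omega_limit f" and L: "\<And>t. t \<ge> L \<Longrightarrow> norm (f (t + \<tau>) - f t) < \<delta>"
  shows "almost_period g \<delta> \<tau>"
  unfolding almost_period_def
proof
  fix x
  obtain t where t: "filterlim t at_top sequentially" and "continuous_on UNIV g"
    and near: "\<forall>R. \<forall>e>0. \<forall>\<^sub>F k in sequentially. \<forall>x. \<bar>x\<bar> \<le> R \<longrightarrow> dist (f (x + t k)) (g x) < e"
    by (rule omega_limit_pointwise[OF g])
  have lim: "(\<lambda>k. f (y + t k)) \<longlonglongrightarrow> g y" for y
  proof (rule tendstoI)
    fix e :: real assume "e > 0"
    from near[rule_format, OF this, of "\<bar>y\<bar>"] show "\<forall>\<^sub>F k in sequentially. dist (f (y + t k)) (g y) < e"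
      by (rule eventually_mono) simp
  qed
  have "(\<lambda>k. norm (f (x + \<tau> + t k) - f (x + t k))) \<longlonglongrightarrow> norm (g (x + \<tau>) - g x)"
    by (intro tendsto_norm tendsto_diff lim)
  moreover have "\<forall>\<^sub>F k in sequentially. L - x \<le> t k"
    using t by (simp add: filterlim_at_top)
  then have "\<forall>\<^sub>F k in sequentially. norm (f (x + \<tau> + t k) - f (x + t k)) \<le> \<delta>"
  proof eventually_elim
    case (elim k)
    then show ?case using L[of "x + t k"] by (simp add: ac_simps)
  qed
  ultimately show "norm (g (x + \<tau>) - g x) \<le> \<delta>"
    by (rule tendsto_upperbound) simp
qed

text \<open>Increments are compared because \<open>primitive f a\<close> and
  \<open>primitive g b\<close> themselves need not be close. The difference of the translated
  primitives has derivative \<open>f (s + a) - g (s + b)\<close>.\<close>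

lemma primitive_difference_bound:
  fixes f g :: "real \<Rightarrow> 'b::banach"
  assumes f: "continuous_on UNIV f" and g: "continuous_on UNIV g"
    and near: "\<And>s. \<bar>s\<bar> \<le> \<bar>x\<bar> \<Longrightarrow> dist (f (s + a)) (g (s + b)) \<le> e"
  shows "norm ((primitive f (x + a) - primitive f a) - (primitive g (x + b) - primitive g b)) \<le> e * \<bar>x\<bar>"
proof -
  have d: "((\<lambda>s. primitive f (s + a) - primitive g (s + b)) has_vector_derivative f (s + a) - g (s + b)) (at s)" for s
    by (intro has_vector_derivative_diff has_vector_derivative_translate primitive_has_vector_derivative f g)
  have "norm (f (s + a) - g (s + b)) \<le> e" if "s \<in> closed_segment 0 x" for s
    using near[of s] that by (auto simp: dist_norm closed_segment_eq_real_ivl split: if_splits)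
  then have "norm ((primitive f (x + a) - primitive g (x + b)) - (primitive f (0 + a) - primitive g (0 + b)))
      \<le> e * \<bar>x - 0\<bar>"
    by (rule vector_derivative_bound[OF d])
  moreover have "(primitive f (x + a) - primitive g (x + b)) - (primitive f (0 + a) - primitive g (0 + b))
      = (primitive f (x + a) - primitive f a) - (primitive g (x + b) - primitive g b)" by simp
  ultimately show ?thesis by (simp only: diff_0_right)
qed

text \<open>\<open>primitive g x\<close> is the limit of the increments of
  \<open>primitive f\<close> from \<open>t k\<close> to \<open>x + t k\<close>, and both endpoints
  are eventually nonnegative.\<close>

lemma omega_limit_primitive_range:
  fixes f :: "real \<Rightarrow> 'b::banach"
  assumes f: "continuous_on UNIV f" and g: "g \<in> omega_limit f"
    and D: "closed D" "\<And>s t. 0 \<le> s \<Longrightarrow> 0 \<le> t \<Longrightarrow> primitive f s - primitive f t \<in> D"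
  shows "range (primitive g) \<subseteq> D"
proof safe
  fix x
  obtain t where t: "filterlim t at_top sequentially" and cg: "continuous_on UNIV g"
    and near: "\<forall>R. \<forall>e>0. \<forall>\<^sub>F k in sequentially. \<forall>x. \<bar>x\<bar> \<le> R \<longrightarrow> dist (f (x + t k)) (g x) < e"
    by (rule omega_limit_pointwise[OF g])
  have "(\<lambda>k. primitive f (x + t k) - primitive f (t k)) \<longlonglongrightarrow> primitive g x"
  proof (rule tendstoI)
    fix e :: real assume e: "e > 0"
    \<comment> \<open>The divisor absorbs the length of the interval, and the added 1 covers
      \<open>x = 0\<close>.\<close>
    have "\<forall>\<^sub>F k in sequentially. \<forall>y. \<bar>y\<bar> \<le> \<bar>x\<bar> \<longrightarrow> dist (f (y + t k)) (g y) < e / (\<bar>x\<bar> + 1)"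
      using e by (intro near[rule_format]) (simp add: add_nonneg_pos)
    then show "\<forall>\<^sub>F k in sequentially. dist (primitive f (x + t k) - primitive f (t k)) (primitive g x) < e"
    proof eventually_elim
      case (elim k)
      then have "norm ((primitive f (x + t k) - primitive f (t k)) - (primitive g (x + 0) - primitive g 0))
          \<le> e / (\<bar>x\<bar> + 1) * \<bar>x\<bar>"
        by (intro primitive_difference_bound f cg) (simp add: less_imp_le)
      also have "\<dots> < e" using e by (simp add: field_simps)
      finally show ?case by (simp add: dist_norm primitive_def)
    qed
  qed
  moreover have "\<forall>\<^sub>F k in sequentially. \<bar>x\<bar> \<le> t k" using t by (simp add: filterlim_at_top)
  then have "\<forall>\<^sub>F k in sequentially. primitive f (x + t k) - primitive f (t k) \<in> D"
    by eventually_elim (rule D(2); linarith)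
  ultimately show "primitive g x \<in> D" using D(1) by (rule_tac Lim_in_closed_set) auto
qed

section \<open>The almost periodic, periodic and stationary cases\<close>

lemma almost_periodic_primitive:
  fixes f :: "real \<Rightarrow> 'b::banach"
  assumes f: "continuous_on UNIV f" and st: "positively_Lagrange_stable f"
    and min: "minimal_set (omega_limit f)" and K: "compact (closure (primitive f ` {0..}))"
    and ap: "positively_remotely_almost_periodic f"
  shows "positively_remotely_almost_periodic (primitive f)"
proof -
  obtain g where g: "g \<in> omega_limit f" using min by (auto simp: minimal_set_def)
  then have cg: "continuous_on UNIV g" by (rule omega_limit_pointwise)
  let ?G = "primitive g"
  let ?K = "closure (primitive f ` {0..})"
  \<comment> \<open>Increments of \<open>primitive f\<close> on the half-line lie in this compact
    difference set, which therefore contains the range of \<open>?G\<close>.\<close>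
  define D where "D = {x - y | x y. x \<in> ?K \<and> y \<in> ?K}"
  have D: "compact D" unfolding D_def using K K by (rule compact_differences)
  have range: "range ?G \<subseteq> D"
  proof (rule omega_limit_primitive_range[OF f g compact_imp_closed[OF D]])
    fix s t :: real assume "0 \<le> s" "0 \<le> t"
    then have "primitive f s \<in> ?K" "primitive f t \<in> ?K" by (auto intro: closure_subset[THEN subsetD])
    then show "primitive f s - primitive f t \<in> D" by (auto simp: D_def)
  qed
  have d: "(?G has_vector_derivative g x) (at x)" for x by (rule primitive_has_vector_derivative[OF cg])
  have P: "\<exists>P. relatively_dense P \<and> (\<forall>\<tau>\<in>P. almost_period g \<delta> \<tau>)" if \<delta>: "\<delta> > 0" for \<delta>
  proof -
    obtain P where "relatively_dense P" "\<forall>\<tau>\<in>P. \<exists>L>0. \<forall>t\<ge>L. norm (f (t + \<tau>) - f t) < \<delta>"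
      using ap \<delta> unfolding positively_remotely_almost_periodic_def by blast
    then show ?thesis using omega_limit_almost_period[OF g] by blast
  qed
  have "\<exists>P. relatively_dense P \<and>
        (\<forall>\<tau>\<in>P. \<exists>L>0. \<forall>t\<ge>L. norm (primitive f (t + \<tau>) - primitive f t) < \<epsilon>)" if e: "\<epsilon> > 0" for \<epsilon>
  proof -
    obtain l where l: "l > 0" "\<And>a t. \<exists>s\<in>{a..a + l}. dist (?G t) (?G s) \<le> \<epsilon>/4"
      using primitive_window_net[OF d P D range, of "\<epsilon>/4"] e by auto
    \<comment> \<open>The net costs \<epsilon>/4 and \<open>\<delta> * l\<close> another
      \<epsilon>/4, which leaves \<epsilon>/2 for the passage from \<open>g\<close> to
      \<open>f\<close>.\<close>
    define \<delta> where "\<delta> = \<epsilon> / (4 * l)"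
    have "\<delta> > 0" using e l by (simp add: \<delta>_def)
    then obtain P where P: "relatively_dense P" "\<And>\<tau>. \<tau> \<in> P \<Longrightarrow> almost_period g \<delta> \<tau>"
      using P by blast
    have "\<exists>L>0. \<forall>t\<ge>L. norm (primitive f (t + \<tau>) - primitive f t) < \<epsilon>" if "\<tau> \<in> P" for \<tau>
    proof -
      have "almost_period ?G (\<epsilon>/4 + \<delta> * l) \<tau>"
        using primitive_almost_period[OF d l(2) bounded_subset[OF compact_imp_bounded[OF D] range] P(2)[OF that]] .
      then have G: "norm (?G (h + \<tau>) - ?G h) \<le> \<epsilon>/2" for h using l by (simp add: almost_period_def \<delta>_def)
      \<comment> \<open>Since \<open>\<tau>\<close> may be negative, its absolute value enters; the
        error accumulated over that length stays below \<epsilon>/2.\<close>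
      define r where "r = \<epsilon> / (2 * (\<bar>\<tau>\<bar> + 1))"
      have r: "r > 0" using e by (simp add: r_def add_nonneg_pos)
      have "\<forall>\<^sub>F h in at_top. \<exists>h'. \<forall>s. \<bar>s\<bar> \<le> \<bar>\<tau>\<bar> \<longrightarrow> dist (f (s + h)) (g (s + h')) < r"
        by (rule eventually_near_orbit[OF st min g r])
      then have "\<forall>\<^sub>F h in at_top. norm (primitive f (h + \<tau>) - primitive f h) < \<epsilon>"
      proof eventually_elim
        case (elim h)
        then obtain h' where h': "\<forall>s. \<bar>s\<bar> \<le> \<bar>\<tau>\<bar> \<longrightarrow> dist (f (s + h)) (g (s + h')) < r" by blast
        have "norm ((primitive f (\<tau> + h) - primitive f h) - (?G (\<tau> + h') - ?G h')) \<le> r * \<bar>\<tau>\<bar>"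
          using h' by (intro primitive_difference_bound f cg) (simp add: less_imp_le)
        also have "\<dots> < \<epsilon>/2" using e by (simp add: r_def field_simps add_nonneg_pos)
        finally have "norm (((primitive f (\<tau> + h) - primitive f h) - (?G (\<tau> + h') - ?G h'))
            + (?G (\<tau> + h') - ?G h')) < \<epsilon>/2 + \<epsilon>/2"
          using G[of h'] by (intro norm_triangle_lt) (simp add: add.commute)
        then show ?case by (simp add: add.commute)
      qed
      then obtain L where "\<forall>t\<ge>L. norm (primitive f (t + \<tau>) - primitive f t) < \<epsilon>"
        by (auto simp: eventually_at_top_linorder)
      then show ?thesis by (intro exI[of _ "max L 1"]) auto
    qed
    with P(1) show ?thesis by blast
  qed
  then show ?thesis
    using continuous_on_primitive[OF f] by (simp add: positively_remotely_almost_periodic_def)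
qed

text \<open>The increment \<open>G t = F (t + \<tau>) - F t\<close> varies slowly, so \<open>n G t\<close> is close to
  \<open>F (t + n \<tau>) - F t\<close>, which is bounded independently of \<open>n\<close>.\<close>

lemma periodic_primitive:
  fixes f :: "real \<Rightarrow> 'b::banach"
  assumes f: "continuous_on UNIV f" and bdd: "bounded (primitive f ` {0..})" and \<tau>: "\<tau> > 0"
    and per: "positively_remotely_periodic \<tau> f"
  shows "positively_remotely_periodic \<tau> (primitive f)"
proof -
  let ?F = "primitive f"
  define G where "G t = ?F (t + \<tau>) - ?F t" for t
  obtain B where B: "\<And>t. t \<ge> 0 \<Longrightarrow> norm (?F t) \<le> B" using bdd by (auto simp: bounded_iff)
  have dG: "(G has_vector_derivative f (t + \<tau>) - f t) (at t)" for t
    unfolding G_def[abs_def]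
    by (intro has_vector_derivative_diff has_vector_derivative_translate primitive_has_vector_derivative f)
  have "\<forall>\<^sub>F t in at_top. norm (G t) < \<epsilon>" if e: "\<epsilon> > 0" for \<epsilon>
  proof -
    \<comment> \<open>With this \<open>n\<close> the bound \<open>2 * B\<close> on increments of
      \<open>?F\<close> is less than half of \<open>real n * \<epsilon>\<close>.\<close>
    obtain n :: nat where n: "4 * B < real n * \<epsilon>" "n > 0"
    proof -
      obtain n :: nat where "4 * B < real n * \<epsilon>" using reals_Archimedean3[OF e] by blast
      moreover have "real n * \<epsilon> \<le> real (Suc n) * \<epsilon>" using e by simp
      ultimately show ?thesis using that[of "Suc n"] by linarith
    qed
    \<comment> \<open>Over a time of at most \<open>real n * \<tau>\<close> the increment
      \<open>G\<close> then changes by at most \<epsilon>/2.\<close>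
    define \<delta> where "\<delta> = \<epsilon> / (2 * real n * \<tau>)"
    have \<delta>: "\<delta> > 0" using e n \<tau> by (simp add: \<delta>_def)
    have "\<forall>\<^sub>F t in at_top. norm (f (t + \<tau>) - f t) < \<delta>"
      using per \<delta> by (auto simp: positively_remotely_periodic_def dest!: order_tendstoD(2))
    then obtain T where T: "\<And>t. t \<ge> T \<Longrightarrow> norm (f (t + \<tau>) - f t) < \<delta>"
      by (auto simp: eventually_at_top_linorder)
    have "norm (G t) < \<epsilon>" if t: "t \<ge> max T 0" for t
    proof -
      have "norm (G (t + real j * \<tau>) - G t) \<le> \<epsilon>/2" if "j < n" for j
      proof -
        have "norm (G (t + real j * \<tau>) - G t) \<le> \<delta> * \<bar>t + real j * \<tau> - t\<bar>"
        proof (rule vector_derivative_bound[OF dG])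
          fix x assume "x \<in> closed_segment t (t + real j * \<tau>)"
          then have "t \<le> x" using \<tau> by (simp add: closed_segment_eq_real_ivl)
          then show "norm (f (x + \<tau>) - f x) \<le> \<delta>" using T[of x] t by simp
        qed
        also have "\<dots> \<le> \<delta> * (real n * \<tau>)" using \<delta> \<tau> that by (intro mult_left_mono) auto
        also have "\<dots> = \<epsilon>/2" using n \<tau> by (simp add: \<delta>_def)
        finally show ?thesis .
      qed
      then have "norm (\<Sum>j<n. G (t + real j * \<tau>) - G t) \<le> real n * (\<epsilon>/2)"
        using sum_norm_bound[of "{..<n}" "\<lambda>j. G (t + real j * \<tau>) - G t" "\<epsilon>/2"] by simp
      moreover have "(\<Sum>j<n. G (t + real j * \<tau>)) = ?F (t + real n * \<tau>) - ?F t"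
        using sum_lessThan_telescope[of "\<lambda>j. ?F (t + real j * \<tau>)" n]
        by (simp add: G_def algebra_simps)
      ultimately have 1: "norm ((?F (t + real n * \<tau>) - ?F t) - real n *\<^sub>R G t) \<le> real n * (\<epsilon>/2)"
        by (simp add: sum_subtractf sum_constant_scaleR)
      have 2: "norm (?F (t + real n * \<tau>) - ?F t) \<le> 2 * B"
        using B[of "t + real n * \<tau>"] B[of t] t \<tau> by (intro norm_triangle_le_diff) simp
      have "real n * norm (G t) = norm ((?F (t + real n * \<tau>) - ?F t) - ((?F (t + real n * \<tau>) - ?F t) - real n *\<^sub>R G t))"
        by simp
      also have "\<dots> \<le> 2 * B + real n * (\<epsilon>/2)"
        by (rule norm_triangle_le_diff[OF add_mono[OF 2 1]])
      also have "\<dots> < real n * \<epsilon>" using n by simp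
      finally show ?thesis using n by simp
    qed
    then show ?thesis unfolding eventually_at_top_linorder by blast
  qed
  then have "((\<lambda>t. norm (G t)) \<longlongrightarrow> 0) at_top" by (intro tendstoI) simp
  then show ?thesis
    using continuous_on_primitive[OF f] by (simp add: positively_remotely_periodic_def G_def)
qed

theorem corollary3p13:
  fixes \<phi> :: "real \<Rightarrow> 'b::banach"
  assumes "\<phi> \<in> topspace compact_open"
    and "positively_Lagrange_stable \<phi>"
    and "minimal_set (omega_limit \<phi>)"
    and "compact (closure (primitive \<phi> ` {0..}))"
  shows "(positively_remotely_almost_periodic \<phi> \<longrightarrow>
            positively_remotely_almost_periodic (primitive \<phi>)) \<and>
         (\<forall>\<tau>>0. positively_remotely_periodic \<tau> \<phi> \<longrightarrow>
            positively_remotely_periodic \<tau> (primitive \<phi>)) \<and>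
         (positively_remotely_stationary \<phi> \<longrightarrow>
            positively_remotely_stationary (primitive \<phi>))"
proof -
  have f: "continuous_on UNIV \<phi>" using assms(1) by (simp add: topspace_compact_open)
  have "bounded (primitive \<phi> ` {0..})"
    using assms(4) bounded_subset[OF compact_imp_bounded closure_subset] by blast
  \<comment> \<open>Stationarity is periodicity for every positive \<open>\<tau>\<close>, so it
    follows from the periodic case.\<close>
  then show ?thesis
    using almost_periodic_primitive[OF f assms(2-4)] periodic_primitive[OF f]
    by (auto simp: positively_remotely_stationary_def)
qed

end
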